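(* Let $\mathcal{G}$ be a hereditary class of graphs, and let $G$ be a graph with $n$ vertices and $m$ edges belonging to the edge-add class $\mathcal{G}^{\mathrm{add}}$ of $\mathcal{G}$. Let $xy$ be a non-edge of $G$ such that $G+xy\in\mathcal{G}$. Let $f$ be a non-decreasing real-valued function with $f(m,n)\in\Omega(m+n)$, and suppose there is an algorithm which, given any graph $H\in\mathcal{G}$ with $n'$ vertices and $m'$ edges and any weight function $w_H\colon V(H)\to\mathbb{R}$, computes a weighted maximum clique of $H$ (together with its weight) in $O(f(m',n'))$ time. Then a weighted maximum clique of $G$ (for any weight function $w_G\colon V(G)\to\mathbb{R}$) can be found in $O(f(m,n))$ time.
   Context: All graphs are finite, simple and undirected. A non-edge of $G$ is a pair of distinct non-adjacent vertices; for a non-edge $xy$, $G+xy$ is the graph obtained by adding the edge $xy$, and for an edge $xy$, $G-xy$ is obtained by deleting it. A class $\mathcal{G}$ of graphs is hereditary if every induced subgraph of a graph in $\mathcal{G}$ belongs to $\mathcal{G}$. The edge-add class $\mathcal{G}^{\mathrm{add}}$ of $\mathcal{G}$ is the class of graphs $G$ such that either $G\in\mathcal{G}$ or $G$ has a non-edge $xy$ with $G+xy\in\mathcal{G}$. Given a graph $G$ and a weight function $w\colon V(G)\to\mathbb{R}$, a weighted maximum clique is a clique $K$ of $G$ maximizing the cumulative weight $W(K)=\sum_{v\in K}w(v)$. *)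

theory Defs
  imports Complex_Main "HOL-Library.Landau_Symbols"
begin

section \<open>Finite simple graphs\<close>

datatype 'a ugraph = Graph (verts: "'a set") (edges: "'a set set")

definition simple_graph :: "'a ugraph \<Rightarrow> bool" where
  "simple_graph G \<longleftrightarrow> finite (verts G) \<and> (\<forall>e\<in>edges G. e \<subseteq> verts G \<and> card e = 2)"

definition nonedge :: "'a ugraph \<Rightarrow> 'a \<Rightarrow> 'a \<Rightarrow> bool" where
  "nonedge G x y \<longleftrightarrow> x \<in> verts G \<and> y \<in> verts G \<and> x \<noteq> y \<and> {x, y} \<notin> edges G"

definition add_edge :: "'a ugraph \<Rightarrow> 'a \<Rightarrow> 'a \<Rightarrow> 'a ugraph" where
  "add_edge G x y = Graph (verts G) (insert {x, y} (edges G))"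

definition induced :: "'a ugraph \<Rightarrow> 'a set \<Rightarrow> 'a ugraph" where
  "induced G S = Graph S {e \<in> edges G. e \<subseteq> S}"

definition graph_class :: "'a ugraph set \<Rightarrow> bool" where
  "graph_class \<G> \<longleftrightarrow> (\<forall>G\<in>\<G>. simple_graph G)"

definition hereditary :: "'a ugraph set \<Rightarrow> bool" where
  "hereditary \<G> \<longleftrightarrow> (\<forall>G\<in>\<G>. \<forall>S\<subseteq>verts G. induced G S \<in> \<G>)"

definition edge_add_class :: "'a ugraph set \<Rightarrow> 'a ugraph set" where
  "edge_add_class \<G> =
     {G. simple_graph G \<and> (G \<in> \<G> \<or> (\<exists>x y. nonedge G x y \<and> add_edge G x y \<in> \<G>))}"

definition clique :: "'a ugraph \<Rightarrow> 'a set \<Rightarrow> bool" where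
  "clique G K \<longleftrightarrow> K \<subseteq> verts G \<and> (\<forall>u\<in>K. \<forall>v\<in>K. u \<noteq> v \<longrightarrow> {u, v} \<in> edges G)"

definition weighted_max_clique :: "'a ugraph \<Rightarrow> ('a \<Rightarrow> real) \<Rightarrow> 'a set \<Rightarrow> bool" where
  "weighted_max_clique G w K \<longleftrightarrow>
     clique G K \<and> (\<forall>K'. clique G K' \<longrightarrow> (\<Sum>v\<in>K'. w v) \<le> (\<Sum>v\<in>K. w v))"


section \<open>A real RAM\<close>

text \<open>
  Algorithms are programs of a unit-cost random access machine with two sorts of storage cells:
  cells for natural numbers, which may be used as addresses, and cells for real numbers, on which
  the field operations and comparisons are exact. The storage is organised in unbounded arrays
  (a scalar variable is cell 0 of an array). The name of an array is a literal of the program text,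
  so a program uses only finitely many of them, whereas the index into an array is computed and
  may itself be read from the storage. There is no multiplication of natural numbers and no
  conversion from real to natural numbers.
\<close>

datatype nexp =
    NConst nat
  | NRead nat nexp
  | NPlus nexp nexp
  | NMinus nexp nexp

datatype rexp =
    OfNat nexp
  | RRead nat nexp
  | RPlus rexp rexp
  | RMinus rexp rexp
  | RTimes rexp rexp
  | RDivide rexp rexp

datatype bexp =
    NLess nexp nexp
  | RLess rexp rexp
  | BNot bexp
  | BAnd bexp bexp

datatype com =
    SKIP
  | NWrite nat nexp nexp
  | RWrite nat nexp rexp
  | Seq com com
  | Cond bexp com com
  | While bexp com

record state =
  nmem :: "nat \<Rightarrow> nat \<Rightarrow> nat"
  rmem :: "nat \<Rightarrow> nat \<Rightarrow> real"

fun nval :: "nexp \<Rightarrow> state \<Rightarrow> nat" where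
  "nval (NConst k) s = k"
| "nval (NRead a i) s = nmem s a (nval i s)"
| "nval (NPlus e e') s = nval e s + nval e' s"
| "nval (NMinus e e') s = nval e s - nval e' s"

fun rval :: "rexp \<Rightarrow> state \<Rightarrow> real" where
  "rval (OfNat e) s = real (nval e s)"
| "rval (RRead a i) s = rmem s a (nval i s)"
| "rval (RPlus e e') s = rval e s + rval e' s"
| "rval (RMinus e e') s = rval e s - rval e' s"
| "rval (RTimes e e') s = rval e s * rval e' s"
| "rval (RDivide e e') s = rval e s / rval e' s"

fun bval :: "bexp \<Rightarrow> state \<Rightarrow> bool" where
  "bval (NLess e e') s \<longleftrightarrow> nval e s < nval e' s"
| "bval (RLess e e') s \<longleftrightarrow> rval e s < rval e' s"
| "bval (BNot b) s \<longleftrightarrow> \<not> bval b s"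
| "bval (BAnd b b') s \<longleftrightarrow> bval b s \<and> bval b' s"

text \<open>
  \<open>exec c s t s'\<close>: started in \<open>s\<close>, the program \<open>c\<close> halts in \<open>s'\<close> after \<open>t\<close> steps. Every
  assignment and every evaluation of a test is one step. The expressions of a fixed program have
  bounded size, so charging for each operation inside them would change \<open>t\<close> by a constant factor
  only.
\<close>

inductive exec :: "com \<Rightarrow> state \<Rightarrow> nat \<Rightarrow> state \<Rightarrow> bool" where
  Skip: "exec SKIP s 1 s"
| NWrite: "exec (NWrite a i e) s 1
     (s\<lparr>nmem := (nmem s)(a := (nmem s a)(nval i s := nval e s))\<rparr>)"
| RWrite: "exec (RWrite a i e) s 1
     (s\<lparr>rmem := (rmem s)(a := (rmem s a)(nval i s := rval e s))\<rparr>)"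
| Seq: "exec c s t s' \<Longrightarrow> exec c' s' t' s'' \<Longrightarrow> exec (Seq c c') s (t + t') s''"
| CondTrue: "bval b s \<Longrightarrow> exec c s t s' \<Longrightarrow> exec (Cond b c c') s (Suc t) s'"
| CondFalse: "\<not> bval b s \<Longrightarrow> exec c' s t s' \<Longrightarrow> exec (Cond b c c') s (Suc t) s'"
| WhileFalse: "\<not> bval b s \<Longrightarrow> exec (While b c) s 1 s"
| WhileTrue: "bval b s \<Longrightarrow> exec c s t s' \<Longrightarrow> exec (While b c) s' t' s'' \<Longrightarrow>
     exec (While b c) s (Suc (t + t')) s''"

inductive_cases exec_SkipE: "exec SKIP s t s'"
inductive_cases exec_NWriteE: "exec (NWrite a i e) s t s'"
inductive_cases exec_RWriteE: "exec (RWrite a i e) s t s'"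
inductive_cases exec_SeqE: "exec (Seq c c') s t s'"
inductive_cases exec_CondE: "exec (Cond b c c') s t s'"
inductive_cases exec_WhileE: "exec (While b c) s t s'"

lemma exec_deterministic:
  assumes "exec c s t s'" and "exec c s u s''"
  shows "u = t \<and> s'' = s'"
  using assms
proof (induction arbitrary: u s'' rule: exec.induct)
  case (Seq c s t s' c' t' s2)
  from Seq.prems show ?case
    by (rule exec_SeqE) (use Seq.IH in blast)
next
  case (CondTrue b s c t s' c')
  from CondTrue.prems show ?case
    by (rule exec_CondE) (use CondTrue in blast)+
next
  case (CondFalse b s c' t s' c)
  from CondFalse.prems show ?case
    by (rule exec_CondE) (use CondFalse in blast)+
next
  case (WhileFalse b s c)
  from WhileFalse.prems show ?case
    by (rule exec_WhileE) (use WhileFalse in simp_all)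
next
  case (WhileTrue b s c t s' t' s2)
  from WhileTrue.prems show ?case
    by (rule exec_WhileE) (use WhileTrue.hyps WhileTrue.IH in blast)+
qed (auto elim: exec_SkipE exec_NWriteE exec_RWriteE)


section \<open>Weighted graphs as input, cliques as output\<close>

text \<open>All cells not covered by the input are initially zero.\<close>

definition array_of :: "'b::zero list \<Rightarrow> nat \<Rightarrow> 'b" where
  "array_of xs i = (if i < length xs then xs ! i else 0)"

definition initial_state :: "nat list list \<Rightarrow> real list list \<Rightarrow> state" where
  "initial_state ns rs =
     \<lparr>nmem = (\<lambda>a. if a < length ns then array_of (ns ! a) else (\<lambda>_. 0)),
      rmem = (\<lambda>a. if a < length rs then array_of (rs ! a) else (\<lambda>_. 0))\<rparr>"

text \<open>
  A graph is presented to a program by an enumeration \<open>vs\<close> of its vertices and a list \<open>es\<close> that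
  contains every edge exactly once, as a pair (in either order) of positions in \<open>vs\<close>. The program
  sees the vertices only as the numbers \<open>0, \<dots>, n - 1\<close>.
\<close>

definition represents :: "'a list \<Rightarrow> (nat \<times> nat) list \<Rightarrow> 'a ugraph \<Rightarrow> bool" where
  "represents vs es G \<longleftrightarrow>
     distinct vs \<and> set vs = verts G \<and>
     (\<forall>(i, j)\<in>set es. i < length vs \<and> j < length vs) \<and>
     distinct (map (\<lambda>(i, j). {vs ! i, vs ! j}) es) \<and>
     set (map (\<lambda>(i, j). {vs ! i, vs ! j}) es) = edges G"

definition graph_arrays :: "'a list \<Rightarrow> (nat \<times> nat) list \<Rightarrow> nat list list" where
  "graph_arrays vs es = [[length vs, length es], map fst es, map snd es]"

text \<open>
  A set of vertices is returned as the number of its elements, in cell 0 of array 0, and the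
  list of their positions in \<open>vs\<close>, without repetition, in array 1.
\<close>

definition output_positions :: "state \<Rightarrow> nat list" where
  "output_positions s = map (nmem s 1) [0..<nmem s 0 0]"

definition outputs_set :: "'a list \<Rightarrow> state \<Rightarrow> 'a set \<Rightarrow> bool" where
  "outputs_set vs s K \<longleftrightarrow>
     distinct (output_positions s) \<and>
     (\<forall>i\<in>set (output_positions s). i < length vs) \<and>
     K = (!) vs ` set (output_positions s)"

text \<open>
  The last condition of the following definition: the weight of the clique is returned in
  cell 0 of the real array 0.
\<close>

definition solves_weighted_max_clique ::
    "'a ugraph set \<Rightarrow> com \<Rightarrow> (nat \<Rightarrow> nat \<Rightarrow> real) \<Rightarrow> bool" where
  "solves_weighted_max_clique \<G> A T \<longleftrightarrow>
     (\<forall>H\<in>\<G>. \<forall>w vs es. represents vs es H \<longrightarrow>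
       (\<exists>t s K. exec A (initial_state (graph_arrays vs es) [map w vs]) t s \<and>
          real t \<le> T (card (edges H)) (card (verts H)) \<and>
          outputs_set vs s K \<and> weighted_max_clique H w K \<and>
          rmem s 0 0 = (\<Sum>v\<in>K. w v)))"

text \<open>
  The positions \<open>i\<close>, \<open>j\<close> of the end vertices of the non-edge are part of the input.
\<close>

definition solves_weighted_max_clique_add ::
    "'a ugraph set \<Rightarrow> com \<Rightarrow> (nat \<Rightarrow> nat \<Rightarrow> real) \<Rightarrow> bool" where
  "solves_weighted_max_clique_add \<G> B T \<longleftrightarrow>
     (\<forall>G\<in>edge_add_class \<G>. \<forall>x y. nonedge G x y \<and> add_edge G x y \<in> \<G> \<longrightarrow>
       (\<forall>w vs es i j. represents vs es G \<and>
          i < length vs \<and> vs ! i = x \<and> j < length vs \<and> vs ! j = y \<longrightarrow>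
         (\<exists>t s K. exec B (initial_state (graph_arrays vs es @ [[i, j]]) [map w vs]) t s \<and>
            real t \<le> T (card (edges G)) (card (verts G)) \<and>
            outputs_set vs s K \<and> weighted_max_clique G w K)))"

text \<open>
  Landau symbols for functions of the number of edges and the number of vertices: the
  inequality may fail for finitely many pairs, that is, the limit is \<open>m + n \<rightarrow> \<infinity>\<close>. Requiring
  both arguments to be large instead would say nothing about, for instance, edgeless graphs.
\<close>

definition bigo2 :: "(nat \<Rightarrow> nat \<Rightarrow> real) \<Rightarrow> (nat \<Rightarrow> nat \<Rightarrow> real) \<Rightarrow> bool" where
  "bigo2 T f \<longleftrightarrow> (\<lambda>(m, n). T m n) \<in> O[cofinite](\<lambda>(m, n). f m n)"

definition bigomega2 :: "(nat \<Rightarrow> nat \<Rightarrow> real) \<Rightarrow> (nat \<Rightarrow> nat \<Rightarrow> real) \<Rightarrow> bool" where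
  "bigomega2 f g \<longleftrightarrow> (\<lambda>(m, n). f m n) \<in> \<Omega>[cofinite](\<lambda>(m, n). g m n)"

end

theory Submission
  imports Defs
begin

text \<open>
  A clique of \<open>G\<close> misses \<open>x\<close> or \<open>y\<close>, so the heavier one of maximum cliques of \<open>G - x\<close> and
  \<open>G - y\<close> is a maximum clique of \<open>G\<close>. Both graphs are induced subgraphs of \<open>G + xy\<close>, hence in
  the class, and they have at most as many vertices and edges as \<open>G\<close>; working with \<open>G + xy\<close>
  itself would cost \<open>f (m + 1) n\<close>, which need not be \<open>O(f m n)\<close>. The given program expects
  zeroed memory, so its two runs use copies of it with disjoint sets of array names.
\<close>

section \<open>Cliques avoiding a vertex\<close>

text \<open>A program sees vertices only as positions \<open>0, ..., n - 1\<close>, so a deletion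
  forces a renumbering of the input and a translation back of the output. This takes time linear in
  \<open>m + n\<close>, which the lower bound on \<open>f\<close> absorbs. Renaming arrays changes
  no step count, so each run costs exactly what it costs from a fresh start, and the weights
  returned by the two runs decide between the cliques by a single comparison. The remaining obstacle
  is the time bound: \<open>T\<close> need not be monotone and is controlled by \<open>f\<close>
  only outside finitely many pairs, whereas the runs take place at pairs below
  \<open>(m, n)\<close>. Hence \<open>T\<close> is replaced by a majorant \<open>U\<close> with
  \<open>T m n \<le> U m' n'\<close> whenever \<open>m \<le> m'\<close> and
  \<open>n \<le> n'\<close>.\<close>

lemma clique_induced_iff: "S \<subseteq> verts G \<Longrightarrow> clique (induced G S) K \<longleftrightarrow> clique G K \<and> K \<subseteq> S"
  by (auto simp: clique_def induced_def)

text \<open>Losing an end vertex removes the added edge as well. This places subgraphs of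
  \<open>G\<close> in a class that contains \<open>add_edge G x y\<close> but possibly not
  \<open>G\<close>.\<close>

lemma induced_add_edge:
  assumes "x \<notin> S \<or> y \<notin> S"
  shows "induced (add_edge G x y) S = induced G S"
  using assms by (auto simp: induced_def add_edge_def)

lemma weighted_max_clique_nonedge:
  assumes "nonedge G x y"
    and "weighted_max_clique (induced G (verts G - {x})) w K"
    and "weighted_max_clique (induced G (verts G - {y})) w L"
    and "(\<Sum>v\<in>L. w v) \<le> (\<Sum>v\<in>K. w v)"
  shows "weighted_max_clique G w K"
proof -
  have "(\<Sum>v\<in>M. w v) \<le> (\<Sum>v\<in>K. w v)" if M: "clique G M" for M
  proof -
    have "x \<notin> M \<or> y \<notin> M"
      using M assms(1) by (auto simp: clique_def nonedge_def)
    moreover have "M \<subseteq> verts G"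
      using M by (simp add: clique_def)
    ultimately have "clique (induced G (verts G - {x})) M \<or> clique (induced G (verts G - {y})) M"
      using M by (auto simp: clique_induced_iff)
    then show ?thesis
      using assms(2-4) by (meson order_trans weighted_max_clique_def)
  qed
  moreover have "clique G K"
    using assms(2) by (simp add: weighted_max_clique_def clique_induced_iff)
  ultimately show ?thesis
    by (simp add: weighted_max_clique_def)
qed

lemma nonedge_sym: "nonedge G x y \<Longrightarrow> nonedge G y x"
  by (auto simp: nonedge_def insert_commute)

lemma card_edges_induced_le: "simple_graph G \<Longrightarrow> card (edges (induced G S)) \<le> card (edges G)"
proof (rule card_mono)
  assume "simple_graph G"
  then have "edges G \<subseteq> Pow (verts G)" "finite (verts G)"
    by (auto simp: simple_graph_def)
  then show "finite (edges G)"
    by (meson finite_Pow_iff finite_subset)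
qed (auto simp: induced_def)


section \<open>Renumbering after the deletion of a position\<close>

text \<open>Subtraction is truncated, so \<open>1 - (i - q)\<close> is 1 if \<open>i \<le> q\<close>
  and 0 otherwise. Machine expressions have no conditional, and this form can be written down as an
  \<open>nexp\<close>.\<close>

definition skip_pos :: "nat \<Rightarrow> nat \<Rightarrow> nat" where
  "skip_pos i q = q + (1 - (i - q))"

text \<open>\<open>1 - (1 - (p - i))\<close> is 1 exactly if \<open>p > i\<close>. Away from the
  deleted position \<open>i\<close> this undoes \<open>skip_pos i\<close>; edges at position
  \<open>i\<close> itself are filtered out before they are renumbered.\<close>

definition unskip_pos :: "nat \<Rightarrow> nat \<Rightarrow> nat" where
  "unskip_pos i p = p - (1 - (1 - (p - i)))"

lemma skip_unskip_pos: "p \<noteq> i \<Longrightarrow> skip_pos i (unskip_pos i p) = p"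
  by (auto simp: skip_pos_def unskip_pos_def)

lemma unskip_pos_less: "p \<noteq> i \<Longrightarrow> p < n \<Longrightarrow> i < n \<Longrightarrow> unskip_pos i p < n - Suc 0"
  by (auto simp: unskip_pos_def)

lemma skip_pos_neq: "skip_pos i q \<noteq> i"
  unfolding skip_pos_def by arith

lemma skip_pos_less: "q < n - 1 \<Longrightarrow> skip_pos i q < n"
  by (auto simp: skip_pos_def)

lemma inj_skip_pos: "inj (skip_pos i)"
proof (rule injI)
  fix p q
  assume "skip_pos i p = skip_pos i q"
  then show "p = q"
    unfolding skip_pos_def by arith
qed

text \<open>Defined through indices because the copying loop fills cell \<open>k\<close> from cell
  \<open>skip_pos i k\<close>.\<close>

definition delete_pos :: "nat \<Rightarrow> 'b list \<Rightarrow> 'b list" where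
  "delete_pos i xs = map (\<lambda>k. xs ! skip_pos i k) [0..<length xs - 1]"

definition delete_edges :: "nat \<Rightarrow> (nat \<times> nat) list \<Rightarrow> (nat \<times> nat) list" where
  "delete_edges i es =
     map (map_prod (unskip_pos i) (unskip_pos i)) (filter (\<lambda>(u, v). u \<noteq> i \<and> v \<noteq> i) es)"

lemma length_delete_pos [simp]: "length (delete_pos i xs) = length xs - 1"
  by (simp add: delete_pos_def)

lemma nth_delete_pos: "k < length xs - 1 \<Longrightarrow> delete_pos i xs ! k = xs ! skip_pos i k"
  by (simp add: delete_pos_def)

lemma map_delete_pos: "map f (delete_pos i xs) = delete_pos i (map f xs)"
  by (auto simp: delete_pos_def skip_pos_less)

lemma nth_delete_unskip_pos:
  "p \<noteq> i \<Longrightarrow> p < length xs \<Longrightarrow> i < length xs \<Longrightarrow> delete_pos i xs ! unskip_pos i p = xs ! p"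
  using unskip_pos_less[of p i "length xs"] by (simp add: nth_delete_pos skip_unskip_pos)

lemma distinct_delete_pos: "distinct xs \<Longrightarrow> distinct (delete_pos i xs)"
  unfolding delete_pos_def distinct_map
  by (auto simp: inj_on_def nth_eq_iff_index_eq skip_pos_less inj_eq[OF inj_skip_pos])

lemma set_delete_pos:
  assumes "distinct xs" "i < length xs"
  shows "set (delete_pos i xs) = set xs - {xs ! i}"
proof (intro equalityI subsetI)
  fix v
  assume "v \<in> set (delete_pos i xs)"
  then obtain k where "k < length xs - 1" "v = xs ! skip_pos i k"
    by (auto simp: delete_pos_def)
  with assms show "v \<in> set xs - {xs ! i}"
    by (simp add: nth_eq_iff_index_eq skip_pos_less skip_pos_neq)
next
  fix v
  assume "v \<in> set xs - {xs ! i}"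
  then obtain p where "p < length xs" "v = xs ! p" "p \<noteq> i"
    by (auto simp: in_set_conv_nth)
  with assms show "v \<in> set (delete_pos i xs)"
    by (metis One_nat_def length_delete_pos nth_delete_unskip_pos nth_mem unskip_pos_less)
qed

text \<open>A renumbered position names in the shortened list the same vertex as before, so the new
  list of vertex pairs is the old one after filtering; distinctness and the edge set follow from
  that.\<close>

lemma represents_delete:
  assumes rep: "represents vs es G" and i: "i < length vs"
  shows "represents (delete_pos i vs) (delete_edges i es) (induced G (verts G - {vs ! i}))"
proof -
  let ?edge = "\<lambda>(u, v). {vs ! u, vs ! v}"
  let ?es = "filter (\<lambda>(u, v). u \<noteq> i \<and> v \<noteq> i) es"
  have dist: "distinct vs" and verts: "set vs = verts G"
    and bound: "\<And>u v. (u, v) \<in> set es \<Longrightarrow> u < length vs \<and> v < length vs"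
    and distE: "distinct (map ?edge es)" and setE: "set (map ?edge es) = edges G"
    using rep by (auto simp: represents_def)
  have edges: "map (\<lambda>(u, v). {delete_pos i vs ! u, delete_pos i vs ! v}) (delete_edges i es)
      = map ?edge ?es"
    using i bound by (auto simp: delete_edges_def nth_delete_unskip_pos)
  \<comment> \<open>Distinctness of \<open>vs\<close> makes the filter on positions agree with the
    restriction to a vertex set.\<close>
  have nth_neq: "vs ! u \<noteq> vs ! i \<longleftrightarrow> u \<noteq> i" if "u < length vs" for u
    using that i dist by (simp add: nth_eq_iff_index_eq)
  have "?edge p \<subseteq> verts G - {vs ! i} \<longleftrightarrow> (case p of (u, v) \<Rightarrow> u \<noteq> i \<and> v \<noteq> i)"
    if "p \<in> set es" for p
    using bound that nth_neq verts by (cases p) (auto simp flip: verts)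
  then have "set (map ?edge ?es) = {e \<in> set (map ?edge es). e \<subseteq> verts G - {vs ! i}}"
    by auto
  then have "set (map ?edge ?es) = edges (induced G (verts G - {vs ! i}))"
    by (simp only: setE induced_def ugraph.sel)
  moreover have "distinct (map ?edge ?es)"
    using distE by (rule distinct_map_filter)
  moreover have "\<forall>(u, v)\<in>set (delete_edges i es). u < length vs - 1 \<and> v < length vs - 1"
    using i bound by (auto simp: delete_edges_def unskip_pos_less)
  ultimately show ?thesis
    unfolding represents_def edges
    using dist i by (simp add: distinct_delete_pos set_delete_pos verts induced_def)
qed


section \<open>Renaming the arrays of a program\<close>

primrec rename_nexp :: "(nat \<Rightarrow> nat) \<Rightarrow> nexp \<Rightarrow> nexp" where
  "rename_nexp \<rho> (NConst k) = NConst k"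
| "rename_nexp \<rho> (NRead a i) = NRead (\<rho> a) (rename_nexp \<rho> i)"
| "rename_nexp \<rho> (NPlus e e') = NPlus (rename_nexp \<rho> e) (rename_nexp \<rho> e')"
| "rename_nexp \<rho> (NMinus e e') = NMinus (rename_nexp \<rho> e) (rename_nexp \<rho> e')"

primrec rename_rexp :: "(nat \<Rightarrow> nat) \<Rightarrow> rexp \<Rightarrow> rexp" where
  "rename_rexp \<rho> (OfNat e) = OfNat (rename_nexp \<rho> e)"
| "rename_rexp \<rho> (RRead a i) = RRead (\<rho> a) (rename_nexp \<rho> i)"
| "rename_rexp \<rho> (RPlus e e') = RPlus (rename_rexp \<rho> e) (rename_rexp \<rho> e')"
| "rename_rexp \<rho> (RMinus e e') = RMinus (rename_rexp \<rho> e) (rename_rexp \<rho> e')"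
| "rename_rexp \<rho> (RTimes e e') = RTimes (rename_rexp \<rho> e) (rename_rexp \<rho> e')"
| "rename_rexp \<rho> (RDivide e e') = RDivide (rename_rexp \<rho> e) (rename_rexp \<rho> e')"

primrec rename_bexp :: "(nat \<Rightarrow> nat) \<Rightarrow> bexp \<Rightarrow> bexp" where
  "rename_bexp \<rho> (NLess e e') = NLess (rename_nexp \<rho> e) (rename_nexp \<rho> e')"
| "rename_bexp \<rho> (RLess e e') = RLess (rename_rexp \<rho> e) (rename_rexp \<rho> e')"
| "rename_bexp \<rho> (BNot b) = BNot (rename_bexp \<rho> b)"
| "rename_bexp \<rho> (BAnd b b') = BAnd (rename_bexp \<rho> b) (rename_bexp \<rho> b')"

primrec rename_com :: "(nat \<Rightarrow> nat) \<Rightarrow> com \<Rightarrow> com" where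
  "rename_com \<rho> SKIP = SKIP"
| "rename_com \<rho> (NWrite a i e) = NWrite (\<rho> a) (rename_nexp \<rho> i) (rename_nexp \<rho> e)"
| "rename_com \<rho> (RWrite a i e) = RWrite (\<rho> a) (rename_nexp \<rho> i) (rename_rexp \<rho> e)"
| "rename_com \<rho> (Seq c c') = Seq (rename_com \<rho> c) (rename_com \<rho> c')"
| "rename_com \<rho> (Cond b c c') = Cond (rename_bexp \<rho> b) (rename_com \<rho> c) (rename_com \<rho> c')"
| "rename_com \<rho> (While b c) = While (rename_bexp \<rho> b) (rename_com \<rho> c)"

definition view :: "(nat \<Rightarrow> nat) \<Rightarrow> state \<Rightarrow> state" where
  "view \<rho> s = \<lparr>nmem = \<lambda>a. nmem s (\<rho> a), rmem = \<lambda>a. rmem s (\<rho> a)\<rparr>"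

lemma view_sel [simp]:
  "nmem (view \<rho> s) a = nmem s (\<rho> a)" "rmem (view \<rho> s) a = rmem s (\<rho> a)"
  by (simp_all add: view_def)

lemma view_eq_iff: "view \<rho> s = v \<longleftrightarrow>
    (\<forall>a. nmem s (\<rho> a) = nmem v a) \<and> (\<forall>a. rmem s (\<rho> a) = rmem v a)"
  by (cases v) (auto simp: view_def fun_eq_iff)

lemma nval_rename [simp]: "nval (rename_nexp \<rho> e) s = nval e (view \<rho> s)"
  by (induction e) simp_all

lemma rval_rename [simp]: "rval (rename_rexp \<rho> e) s = rval e (view \<rho> s)"
  by (induction e) simp_all

lemma bval_rename [simp]: "bval (rename_bexp \<rho> b) s = bval b (view \<rho> s)"
  by (induction b) simp_all

text \<open>A step-by-step simulation, hence the same \<open>t\<close>. Injectivity ensures that a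
  write to \<open>\<rho> a\<close> changes no other array visible through \<open>\<rho>\<close>; the
  frame part protects the input and the other run.\<close>

lemma exec_rename:
  assumes "exec c s t s'" and "inj \<rho>" and "view \<rho> S = s"
  shows "\<exists>S'. exec (rename_com \<rho> c) S t S' \<and> view \<rho> S' = s' \<and>
    (\<forall>a. a \<notin> range \<rho> \<longrightarrow> nmem S' a = nmem S a \<and> rmem S' a = rmem S a)"
  using assms(1,3)
proof (induction arbitrary: S rule: exec.induct)
  case (Skip s)
  then show ?case
    using exec.Skip[of S] by (intro exI[of _ S]) simp
next
  case (NWrite a i e s)
  have "view \<rho> (S\<lparr>nmem := (nmem S)(\<rho> a := (nmem S (\<rho> a))(nval i s := nval e s))\<rparr>) =
      s\<lparr>nmem := (nmem s)(a := (nmem s a)(nval i s := nval e s))\<rparr>"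
    using assms(2) by (auto simp: view_def fun_eq_iff inj_eq simp flip: NWrite.prems)
  moreover have "exec (rename_com \<rho> (NWrite a i e)) S 1
      (S\<lparr>nmem := (nmem S)(\<rho> a := (nmem S (\<rho> a))(nval i s := nval e s))\<rparr>)"
    using exec.NWrite[of "\<rho> a" "rename_nexp \<rho> i" "rename_nexp \<rho> e" S] NWrite.prems by simp
  ultimately show ?case
    by (intro exI conjI) auto
next
  case (RWrite a i e s)
  have "view \<rho> (S\<lparr>rmem := (rmem S)(\<rho> a := (rmem S (\<rho> a))(nval i s := rval e s))\<rparr>) =
      s\<lparr>rmem := (rmem s)(a := (rmem s a)(nval i s := rval e s))\<rparr>"
    using assms(2) by (auto simp: view_def fun_eq_iff inj_eq simp flip: RWrite.prems)
  moreover have "exec (rename_com \<rho> (RWrite a i e)) S 1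
      (S\<lparr>rmem := (rmem S)(\<rho> a := (rmem S (\<rho> a))(nval i s := rval e s))\<rparr>)"
    using exec.RWrite[of "\<rho> a" "rename_nexp \<rho> i" "rename_rexp \<rho> e" S] RWrite.prems by simp
  ultimately show ?case
    by (intro exI conjI) auto
next
  case (Seq c s t s' c' t' s'')
  obtain S' where S': "exec (rename_com \<rho> c) S t S'" "view \<rho> S' = s'"
      "\<forall>a. a \<notin> range \<rho> \<longrightarrow> nmem S' a = nmem S a \<and> rmem S' a = rmem S a"
    using Seq.IH(1)[OF Seq.prems] by blast
  obtain S'' where S'': "exec (rename_com \<rho> c') S' t' S''" "view \<rho> S'' = s''"
      "\<forall>a. a \<notin> range \<rho> \<longrightarrow> nmem S'' a = nmem S' a \<and> rmem S'' a = rmem S' a"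
    using Seq.IH(2)[OF S'(2)] by blast
  have "exec (rename_com \<rho> (Seq c c')) S (t + t') S''"
    using S'(1) S''(1) by (simp add: exec.Seq)
  with S'(3) S''(2,3) show ?case
    by (intro exI[of _ S'']) simp
next
  case (CondTrue b s c t s' c')
  then obtain S' where S': "exec (rename_com \<rho> c) S t S'" "view \<rho> S' = s'"
      "\<forall>a. a \<notin> range \<rho> \<longrightarrow> nmem S' a = nmem S a \<and> rmem S' a = rmem S a"
    by blast
  have "exec (rename_com \<rho> (Cond b c c')) S (Suc t) S'"
    using CondTrue.hyps(1) CondTrue.prems S'(1) by (simp add: exec.CondTrue)
  with S' show ?case
    by blast
next
  case (CondFalse b s c' t s' c)
  then obtain S' where S': "exec (rename_com \<rho> c') S t S'" "view \<rho> S' = s'"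
      "\<forall>a. a \<notin> range \<rho> \<longrightarrow> nmem S' a = nmem S a \<and> rmem S' a = rmem S a"
    by blast
  have "exec (rename_com \<rho> (Cond b c c')) S (Suc t) S'"
    using CondFalse.hyps(1) CondFalse.prems S'(1) by (simp add: exec.CondFalse)
  with S' show ?case
    by blast
next
  case (WhileFalse b s c)
  then have "exec (rename_com \<rho> (While b c)) S 1 S"
    using exec.WhileFalse[of "rename_bexp \<rho> b" S "rename_com \<rho> c"] by simp
  with WhileFalse.prems show ?case
    by blast
next
  case (WhileTrue b s c t s' t' s'')
  obtain S' where S': "exec (rename_com \<rho> c) S t S'" "view \<rho> S' = s'"
      "\<forall>a. a \<notin> range \<rho> \<longrightarrow> nmem S' a = nmem S a \<and> rmem S' a = rmem S a"
    using WhileTrue.IH(1)[OF WhileTrue.prems] by blast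
  obtain S'' where S'': "exec (rename_com \<rho> (While b c)) S' t' S''" "view \<rho> S'' = s''"
      "\<forall>a. a \<notin> range \<rho> \<longrightarrow> nmem S'' a = nmem S' a \<and> rmem S'' a = rmem S' a"
    using WhileTrue.IH(2)[OF S'(2)] by blast
  have "exec (rename_com \<rho> (While b c)) S (Suc (t + t')) S''"
    using WhileTrue.hyps(1) WhileTrue.prems S'(1) S''(1) by (simp add: exec.WhileTrue)
  with S'(3) S''(2,3) show ?case
    by (intro exI[of _ S'']) simp
qed


section \<open>Total correctness with a time bound\<close>

definition halts_within :: "com \<Rightarrow> state \<Rightarrow> nat \<Rightarrow> (state \<Rightarrow> bool) \<Rightarrow> bool" where
  "halts_within c s b Q \<longleftrightarrow> (\<exists>t s'. exec c s t s' \<and> t \<le> b \<and> Q s')"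

lemma halts_within_weaken:
  "halts_within c s b Q \<Longrightarrow> b \<le> b' \<Longrightarrow> (\<And>s'. Q s' \<Longrightarrow> Q' s') \<Longrightarrow> halts_within c s b' Q'"
  unfolding halts_within_def by (meson order_trans)

lemma halts_within_SKIP: "Q s \<Longrightarrow> halts_within SKIP s 1 Q"
  unfolding halts_within_def by (blast intro: exec.Skip)

lemma halts_within_NWrite:
  "Q (s\<lparr>nmem := (nmem s)(a := (nmem s a)(nval i s := nval e s))\<rparr>) \<Longrightarrow>
    halts_within (NWrite a i e) s 1 Q"
  unfolding halts_within_def by (blast intro: exec.NWrite)

lemma halts_within_RWrite:
  "Q (s\<lparr>rmem := (rmem s)(a := (rmem s a)(nval i s := rval e s))\<rparr>) \<Longrightarrow>
    halts_within (RWrite a i e) s 1 Q"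
  unfolding halts_within_def by (blast intro: exec.RWrite)

text \<open>Weakest-precondition style: the second command sits in the postcondition of the first,
  so introduction rules split a program without naming intermediate assertions, and the bounds add
  up.\<close>

lemma halts_within_Seq:
  "halts_within c s b (\<lambda>s'. halts_within c' s' b' Q) \<Longrightarrow> halts_within (Seq c c') s (b + b') Q"
  unfolding halts_within_def by (meson exec.Seq add_mono)

lemma halts_within_Cond:
  "(bval e s \<Longrightarrow> halts_within c s b Q) \<Longrightarrow> (\<not> bval e s \<Longrightarrow> halts_within c' s b' Q) \<Longrightarrow>
    halts_within (Cond e c c') s (Suc (max b b')) Q"
  unfolding halts_within_def
  by (cases "bval e s") (meson exec.CondTrue exec.CondFalse Suc_le_mono le_max_iff_disj)+

text \<open>The number \<open>N\<close> of rounds is fixed in advance and the invariant is indexed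
  by the round, which replaces a termination measure. A round costs \<open>b\<close> and one test;
  the final 1 is the failing test.\<close>

lemma halts_within_While:
  assumes step: "\<And>k s. k < N \<Longrightarrow> P k s \<Longrightarrow> bval e s \<and> halts_within c s b (P (Suc k))"
    and stop: "\<And>s. P N s \<Longrightarrow> \<not> bval e s"
    and init: "P 0 s"
  shows "halts_within (While e c) s (N * Suc b + 1) (P N)"
proof -
  \<comment> \<open>Induction from \<open>N\<close> downwards: when the invariant holds at index
    \<open>k\<close>, there are \<open>N - k\<close> rounds ahead.\<close>
  have "halts_within (While e c) s ((N - k) * Suc b + 1) (P N)" if "k \<le> N" "P k s" for k s
    using that
  proof (induction arbitrary: s rule: inc_induct)
    case base
    then show ?case
      using stop[OF base] exec.WhileFalse[of e s c] by (auto simp: halts_within_def)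
  next
    case (step k)
    from assms(1)[OF step.hyps(2) step.prems] obtain t s'
      where s': "bval e s" "exec c s t s'" "t \<le> b" "P (Suc k) s'"
      by (auto simp: halts_within_def)
    from step.IH[OF s'(4)] obtain t' s''
      where s'': "exec (While e c) s' t' s''" "t' \<le> (N - Suc k) * Suc b + 1" "P N s''"
      by (auto simp: halts_within_def)
    have "N - k = Suc (N - Suc k)"
      using step.hyps(2) by simp
    then have "Suc (t + t') \<le> (N - k) * Suc b + 1"
      using s'(3) s''(2) by simp
    with exec.WhileTrue[OF s'(1,2) s''(1)] s''(3) show ?case
      by (auto simp: halts_within_def)
  qed
  from this[of 0 s] init show ?thesis
    by simp
qed

lemmas halts_within_intros =
  halts_within_Seq halts_within_Cond halts_within_NWrite halts_within_RWrite halts_within_SKIP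


section \<open>The program\<close>

text \<open>
  The input occupies the arrays 0 to 3; the two runs of the given program live in renamed arrays.
  Cell 2 of array 3 serves as loop counter.
\<close>

definition counter :: nexp where
  "counter = NRead 3 (NConst 2)"

definition set_counter :: "nexp \<Rightarrow> com" where
  "set_counter e = NWrite 3 (NConst 2) e"

definition skip_nexp :: "nexp \<Rightarrow> nexp \<Rightarrow> nexp" where
  "skip_nexp i q = NPlus q (NMinus (NConst 1) (NMinus i q))"

definition unskip_nexp :: "nexp \<Rightarrow> nexp \<Rightarrow> nexp" where
  "unskip_nexp i p = NMinus p (NMinus (NConst 1) (NMinus (NConst 1) (NMinus p i)))"

definition neq_bexp :: "nexp \<Rightarrow> nexp \<Rightarrow> bexp" where
  "neq_bexp e e' = BNot (BAnd (BNot (NLess e e')) (BNot (NLess e' e)))"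

text \<open>The bound is evaluated anew at each test; the rule for this loop therefore asks the
  invariant to fix its value.\<close>

definition for_loop :: "nexp \<Rightarrow> com \<Rightarrow> com" where
  "for_loop N c = Seq (set_counter (NConst 0))
     (While (NLess counter N) (Seq c (set_counter (NPlus counter (NConst 1)))))"

text \<open>Cell 1 of array \<open>\<rho> 0\<close>, the edge count of the copied graph, doubles as
  the write position: it counts the edges kept so far and ends with the right value.\<close>

definition copy_edge :: "(nat \<Rightarrow> nat) \<Rightarrow> nat \<Rightarrow> com" where
  "copy_edge \<rho> d =
     Cond (BAnd (neq_bexp (NRead 1 counter) (NRead 3 (NConst d)))
                (neq_bexp (NRead 2 counter) (NRead 3 (NConst d))))
       (Seq (NWrite (\<rho> 1) (NRead (\<rho> 0) (NConst 1))
               (unskip_nexp (NRead 3 (NConst d)) (NRead 1 counter)))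
       (Seq (NWrite (\<rho> 2) (NRead (\<rho> 0) (NConst 1))
               (unskip_nexp (NRead 3 (NConst d)) (NRead 2 counter)))
            (NWrite (\<rho> 0) (NConst 1) (NPlus (NRead (\<rho> 0) (NConst 1)) (NConst 1)))))
       SKIP"

definition copy_weight :: "(nat \<Rightarrow> nat) \<Rightarrow> nat \<Rightarrow> com" where
  "copy_weight \<rho> d = RWrite (\<rho> 0) counter (RRead 0 (skip_nexp (NRead 3 (NConst d)) counter))"

definition prepare :: "(nat \<Rightarrow> nat) \<Rightarrow> nat \<Rightarrow> com" where
  "prepare \<rho> d =
     Seq (for_loop (NRead 0 (NConst 1)) (copy_edge \<rho> d))
    (Seq (for_loop (NMinus (NRead 0 (NConst 0)) (NConst 1)) (copy_weight \<rho> d))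
         (NWrite (\<rho> 0) (NConst 0) (NMinus (NRead 0 (NConst 0)) (NConst 1))))"

text \<open>The output goes to arrays 0 and 1, which still hold input. Overwriting them is safe,
  since only array 3 and the region of \<open>\<rho>\<close> are read from here on. Stale cells
  beyond the new count are not part of the output.\<close>

definition emit :: "(nat \<Rightarrow> nat) \<Rightarrow> nat \<Rightarrow> com" where
  "emit \<rho> d =
     Seq (for_loop (NRead (\<rho> 0) (NConst 0))
           (NWrite 1 counter (skip_nexp (NRead 3 (NConst d)) (NRead (\<rho> 1) counter))))
         (NWrite 0 (NConst 0) (NRead (\<rho> 0) (NConst 0)))"

text \<open>Names 0 to 3 belong to the input. From 4 on, even names serve the first run and odd
  names the second, so every array name of the given program has a place in both.\<close>

definition first_region :: "nat \<Rightarrow> nat" where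
  "first_region a = 2 * a + 4"

definition second_region :: "nat \<Rightarrow> nat" where
  "second_region a = 2 * a + 5"

definition edge_add_clique :: "com \<Rightarrow> com" where
  "edge_add_clique A =
     Seq (prepare first_region 0)
    (Seq (rename_com first_region A)
    (Seq (prepare second_region 1)
    (Seq (rename_com second_region A)
         (Cond (RLess (RRead (first_region 0) (NConst 0)) (RRead (second_region 0) (NConst 0)))
           (emit second_region 1)
           (emit first_region 0)))))"

section \<open>Values of the auxiliary expressions and the rule for counted loops\<close>

lemma nval_skip_nexp [simp]: "nval (skip_nexp i q) s = skip_pos (nval i s) (nval q s)"
  by (simp add: skip_nexp_def skip_pos_def)

lemma nval_unskip_nexp [simp]: "nval (unskip_nexp i p) s = unskip_pos (nval i s) (nval p s)"
  by (simp add: unskip_nexp_def unskip_pos_def)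

lemma bval_neq_bexp [simp]: "bval (neq_bexp e e') s \<longleftrightarrow> nval e s \<noteq> nval e' s"
  by (auto simp: neq_bexp_def)

lemma nval_counter [simp]: "nval counter s = nmem s 3 2"
  by (simp add: counter_def)

text \<open>The body has to leave the counter alone and to establish the invariant for the state
  after the increment. A round costs \<open>b\<close>, a test and an increment; the final 2 is the
  initialisation and the failing test.\<close>

lemma halts_within_for_loop:
  assumes init: "P 0 (s\<lparr>nmem := (nmem s)(3 := (nmem s 3)(2 := 0))\<rparr>)"
    and bound: "\<And>k s. P k s \<Longrightarrow> nval e s = N"
    and step: "\<And>k s. k < N \<Longrightarrow> P k s \<Longrightarrow> nmem s 3 2 = k \<Longrightarrow>
      halts_within c s b (\<lambda>s'. nmem s' 3 2 = k \<and>
        P (Suc k) (s'\<lparr>nmem := (nmem s')(3 := (nmem s' 3)(2 := Suc k))\<rparr>))"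
  shows "halts_within (for_loop e c) s (N * (b + 2) + 2) (P N)"
proof -
  let ?P = "\<lambda>k s. P k s \<and> nmem s 3 2 = k"
  let ?s = "s\<lparr>nmem := (nmem s)(3 := (nmem s 3)(2 := 0))\<rparr>"
  have "halts_within (While (NLess counter e) (Seq c (set_counter (NPlus counter (NConst 1)))))
      ?s (N * Suc (b + 1) + 1) (?P N)"
  proof (rule halts_within_While)
    fix k s
    assume "k < N" "?P k s"
    then have "halts_within (Seq c (set_counter (NPlus counter (NConst 1)))) s (b + 1) (?P (Suc k))"
      unfolding set_counter_def
      by (intro halts_within_Seq halts_within_weaken[OF step, of k s] halts_within_NWrite) auto
    with \<open>k < N\<close> \<open>?P k s\<close> show "bval (NLess counter e) s \<and>
        halts_within (Seq c (set_counter (NPlus counter (NConst 1)))) s (b + 1) (?P (Suc k))"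
      using bound[of k s] by simp
  qed (use init bound in auto)
  then have "halts_within (for_loop e c) s (1 + (N * Suc (b + 1) + 1)) (?P N)"
    unfolding for_loop_def set_counter_def
    by (intro halts_within_Seq halts_within_NWrite) simp
  then show ?thesis
    by (rule halts_within_weaken) auto
qed

text \<open>Array 3 is described in cells 0 and 1 only, since cell 2 changes as the loop counter.
  \<open>p d\<close> is the position deleted in run \<open>d\<close>.\<close>

definition holds_input ::
    "nat \<Rightarrow> (nat \<times> nat) list \<Rightarrow> (nat \<Rightarrow> nat) \<Rightarrow> real list \<Rightarrow> state \<Rightarrow> bool" where
  "holds_input n es p ws s \<longleftrightarrow>
     nmem s 0 = array_of [n, length es] \<and>
     nmem s 1 = array_of (map fst es) \<and>
     nmem s 2 = array_of (map snd es) \<and>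
     (\<forall>d<2. nmem s 3 d = p d) \<and>
     rmem s 0 = array_of ws"

text \<open>Arrays are padded with zeros, so a write to the first free cell is an append; this turns
  the copying loops into list operations.\<close>

lemma array_of_append: "(array_of xs)(length xs := x) = array_of (xs @ [x])"
  by (auto simp: array_of_def fun_eq_iff nth_append)

lemma array_of_Nil: "array_of [] = (\<lambda>_. 0)"
  by (simp add: array_of_def fun_eq_iff)

lemma array_of_pair: "array_of [x, y] = (\<lambda>_. 0)(0 := x, 1 := y)"
  by (auto simp: array_of_def fun_eq_iff nth_Cons split: nat.splits)

lemma delete_edges_take_Suc:
  assumes "k < length es"
  shows "delete_edges i (take (Suc k) es) = delete_edges i (take k es) @
    (if fst (es ! k) \<noteq> i \<and> snd (es ! k) \<noteq> i
     then [(unskip_pos i (fst (es ! k)), unskip_pos i (snd (es ! k)))] else [])"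
  using assms by (auto simp: delete_edges_def take_Suc_conv_app_nth split: prod.splits)

text \<open>\<open>\<rho>\<close> is the region being worked on and \<open>\<sigma>\<close> the one
  that must survive; the two interpretations exchange these roles. Names above 3 keep writes to a
  region away from the input.\<close>

locale two_regions =
  fixes \<rho> \<sigma> :: "nat \<Rightarrow> nat"
  assumes inj_region: "inj \<rho>"
    and region_gt: "\<rho> a > 3" "\<sigma> a > 3"
    and regions_disjoint: "\<rho> a \<noteq> \<sigma> b"
begin

lemma region_simps [simp]:
  "\<rho> a = \<rho> b \<longleftrightarrow> a = b" "\<rho> a \<noteq> \<sigma> b" "\<sigma> a \<noteq> \<rho> b"
  "\<rho> a \<noteq> 0" "\<rho> a \<noteq> 1" "\<rho> a \<noteq> Suc 0" "\<rho> a \<noteq> 2" "\<rho> a \<noteq> 3"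
  "0 \<noteq> \<rho> a" "1 \<noteq> \<rho> a" "Suc 0 \<noteq> \<rho> a" "2 \<noteq> \<rho> a" "3 \<noteq> \<rho> a"
  "\<sigma> a \<noteq> 0" "\<sigma> a \<noteq> 1" "\<sigma> a \<noteq> Suc 0" "\<sigma> a \<noteq> 2" "\<sigma> a \<noteq> 3"
  using inj_region region_gt[of a] regions_disjoint[of a b] regions_disjoint[of b a]
  by (auto simp: inj_eq)

lemma copy_edges_correct:
  assumes "holds_input n es p ws s" "d < 2"
    and "view \<rho> s = initial_state [] []" "view \<sigma> s = v"
  shows "halts_within (for_loop (NRead 0 (NConst 1)) (copy_edge \<rho> d)) s (length es * 6 + 2)
    (\<lambda>s'. holds_input n es p ws s' \<and> view \<sigma> s' = v \<and>
       view \<rho> s' = initial_state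
         [[0, length (delete_edges (p d) es)], map fst (delete_edges (p d) es),
          map snd (delete_edges (p d) es)] [])"
proof -
  \<comment> \<open>\<open>D k\<close> is what has been copied after \<open>k\<close> source edges.
    The other arrays of the region are kept zero because the region must end up looking like an
    initial state.\<close>
  define D where "D k = delete_edges (p d) (take k es)" for k
  define P where "P k s \<longleftrightarrow> holds_input n es p ws s \<and> view \<sigma> s = v \<and>
      nmem s (\<rho> 0) = array_of [0, length (D k)] \<and>
      nmem s (\<rho> 1) = array_of (map fst (D k)) \<and>
      nmem s (\<rho> 2) = array_of (map snd (D k)) \<and>
      (\<forall>a>2. nmem s (\<rho> a) = (\<lambda>_. 0)) \<and> (\<forall>a. rmem s (\<rho> a) = (\<lambda>_. 0))" for k s
  have "halts_within (for_loop (NRead 0 (NConst 1)) (copy_edge \<rho> d)) s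
      (length es * (4 + 2) + 2) (P (length es))"
  proof (rule halts_within_for_loop)
    show "P 0 (s\<lparr>nmem := (nmem s)(3 := (nmem s 3)(2 := 0))\<rparr>)"
      using assms by (auto simp: P_def D_def delete_edges_def holds_input_def view_eq_iff
          initial_state_def array_of_pair array_of_Nil fun_eq_iff)
    show "nval (NRead 0 (NConst 1)) s = length es" if "P k s" for k s
      using that by (simp add: P_def holds_input_def array_of_pair)
    fix k s
    assume k: "k < length es" and P: "P k s" and ctr: "nmem s 3 2 = k"
    have vals: "nmem s (Suc 0) k = fst (es ! k)" "nmem s 2 k = snd (es ! k)" "nmem s 3 d = p d"
      "nmem s (\<rho> 0) (Suc 0) = length (D k)"
      using P k assms(2) by (auto simp: P_def holds_input_def array_of_def)
    have upd: "(array_of (map fst (D k)))(length (D k) := x) = array_of (map fst (D k) @ [x])"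
      "(array_of (map snd (D k)))(length (D k) := x) = array_of (map snd (D k) @ [x])" for x
      using array_of_append[of "map fst (D k)"] array_of_append[of "map snd (D k)"] by simp_all
    have DS: "D (Suc k) = D k @ (if fst (es ! k) \<noteq> p d \<and> snd (es ! k) \<noteq> p d
     then [(unskip_pos (p d) (fst (es ! k)), unskip_pos (p d) (snd (es ! k)))] else [])"
      unfolding D_def using k by (rule delete_edges_take_Suc)
    \<comment> \<open>A test followed by three writes or by \<open>SKIP\<close>; the sum keeps the
      shape that the introduction rules produce.\<close>
    have "halts_within (copy_edge \<rho> d) s (Suc (max (1 + (1 + 1)) 1)) (\<lambda>s'. nmem s' 3 2 = k \<and>
        P (Suc k) (s'\<lparr>nmem := (nmem s')(3 := (nmem s' 3)(2 := Suc k))\<rparr>))"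
      unfolding copy_edge_def using P ctr vals DS upd
      by (intro halts_within_intros)
        (auto simp: P_def holds_input_def view_eq_iff array_of_pair)
    then show "halts_within (copy_edge \<rho> d) s 4 (\<lambda>s'. nmem s' 3 2 = k \<and>
        P (Suc k) (s'\<lparr>nmem := (nmem s')(3 := (nmem s' 3)(2 := Suc k))\<rparr>))"
      by (rule halts_within_weaken) simp_all
  qed
  then show ?thesis
  proof (rule halts_within_weaken)
    fix s'
    assume "P (length es) s'"
    then show "holds_input n es p ws s' \<and> view \<sigma> s' = v \<and> view \<rho> s' = initial_state
         [[0, length (delete_edges (p d) es)], map fst (delete_edges (p d) es),
          map snd (delete_edges (p d) es)] []"
      by (auto simp: P_def D_def view_eq_iff initial_state_def nth_Cons numeral_2_eq_2
          split: nat.splits)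
  qed simp
qed

lemma copy_weights_correct:
  assumes "holds_input n es p ws s" "d < 2" "length ws = n"
    and "view \<rho> s = initial_state ns []" "view \<sigma> s = v"
  shows "halts_within (for_loop (NMinus (NRead 0 (NConst 0)) (NConst 1)) (copy_weight \<rho> d)) s
    (n * 3 + 2)
    (\<lambda>s'. holds_input n es p ws s' \<and> view \<sigma> s' = v \<and>
       view \<rho> s' = initial_state ns [delete_pos (p d) ws])"
proof -
  \<comment> \<open>For \<open>k\<close> up to \<open>n - 1\<close>, the first \<open>k\<close>
    entries of \<open>delete_pos (p d) ws\<close>.\<close>
  define D where "D k = map (\<lambda>k. ws ! skip_pos (p d) k) [0..<k]" for k
  define P where "P k s \<longleftrightarrow> holds_input n es p ws s \<and> view \<sigma> s = v \<and>
      (\<forall>a. nmem s (\<rho> a) = nmem (initial_state ns []) a) \<and>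
      rmem s (\<rho> 0) = array_of (D k) \<and> (\<forall>a>0. rmem s (\<rho> a) = (\<lambda>_. 0))" for k s
  have "halts_within (for_loop (NMinus (NRead 0 (NConst 0)) (NConst 1)) (copy_weight \<rho> d)) s
      ((n - 1) * (1 + 2) + 2) (P (n - 1))"
  proof (rule halts_within_for_loop)
    show "P 0 (s\<lparr>nmem := (nmem s)(3 := (nmem s 3)(2 := 0))\<rparr>)"
      using assms by (auto simp: P_def D_def holds_input_def view_eq_iff
          initial_state_def array_of_Nil)
    show "nval (NMinus (NRead 0 (NConst 0)) (NConst 1)) s = n - 1" if "P k s" for k s
      using that by (simp add: P_def holds_input_def array_of_pair)
    fix k s
    assume k: "k < n - 1" and P: "P k s" and ctr: "nmem s 3 2 = k"
    have "rmem s 0 (skip_pos (p d) k) = ws ! skip_pos (p d) k" "nmem s 3 d = p d"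
      using P k assms(2,3) skip_pos_less[OF k]
      by (auto simp: P_def holds_input_def array_of_def)
    moreover have "(array_of (D k))(k := ws ! skip_pos (p d) k) = array_of (D (Suc k))"
      using array_of_append[of "D k"] by (simp add: D_def)
    ultimately show "halts_within (copy_weight \<rho> d) s 1 (\<lambda>s'. nmem s' 3 2 = k \<and>
        P (Suc k) (s'\<lparr>nmem := (nmem s')(3 := (nmem s' 3)(2 := Suc k))\<rparr>))"
      unfolding copy_weight_def using P ctr
      by (intro halts_within_intros) (auto simp: P_def holds_input_def view_eq_iff)
  qed
  then show ?thesis
  proof (rule halts_within_weaken)
    fix s'
    assume "P (n - 1) s'"
    then show "holds_input n es p ws s' \<and> view \<sigma> s' = v \<and>
        view \<rho> s' = initial_state ns [delete_pos (p d) ws]"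
      using assms(3) by (auto simp: P_def D_def delete_pos_def view_eq_iff initial_state_def)
  qed simp
qed

lemma prepare_correct:
  assumes "holds_input n es p ws s" "d < 2" "length ws = n"
    and "view \<rho> s = initial_state [] []" "view \<sigma> s = v"
  shows "halts_within (prepare \<rho> d) s (6 * length es + 3 * n + 5)
    (\<lambda>s'. holds_input n es p ws s' \<and> view \<sigma> s' = v \<and>
       view \<rho> s' = initial_state
         [[n - 1, length (delete_edges (p d) es)], map fst (delete_edges (p d) es),
          map snd (delete_edges (p d) es)] [delete_pos (p d) ws])"
proof -
  let ?es = "delete_edges (p d) es"
  have set_size: "halts_within (NWrite (\<rho> 0) (NConst 0) (NMinus (NRead 0 (NConst 0)) (NConst 1))) s 1
    (\<lambda>s'. holds_input n es p ws s' \<and> view \<sigma> s' = v \<and>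
       view \<rho> s' = initial_state [[n - 1, length ?es], map fst ?es, map snd ?es]
         [delete_pos (p d) ws])"
    if "holds_input n es p ws s \<and> view \<sigma> s = v \<and>
       view \<rho> s = initial_state [[0, length ?es], map fst ?es, map snd ?es]
         [delete_pos (p d) ws]" for s
    using that
    by (intro halts_within_NWrite)
      (auto simp: holds_input_def view_eq_iff initial_state_def array_of_pair nth_Cons
        split: nat.splits)
  have "halts_within (prepare \<rho> d) s ((length es * 6 + 2) + ((n * 3 + 2) + 1))
    (\<lambda>s'. holds_input n es p ws s' \<and> view \<sigma> s' = v \<and>
       view \<rho> s' = initial_state [[n - 1, length ?es], map fst ?es, map snd ?es]
         [delete_pos (p d) ws])"
    unfolding prepare_def
    by (intro halts_within_Seq halts_within_weaken[OF copy_edges_correct[OF assms(1,2,4,5)]]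
        halts_within_weaken[OF copy_weights_correct, of n es p ws _ d] set_size assms order_refl) auto
  then show ?thesis
    by (rule halts_within_weaken) auto
qed

text \<open>Names 0 to 3 and those of \<open>\<sigma>\<close> lie outside the range of
  \<open>\<rho>\<close>, so the frame part of \<open>exec_rename\<close> applies to them.\<close>

lemma rename_correct:
  assumes "exec A (view \<rho> s) t r" and "holds_input n es p ws s" and "view \<sigma> s = v"
  shows "halts_within (rename_com \<rho> A) s t
    (\<lambda>s'. holds_input n es p ws s' \<and> view \<sigma> s' = v \<and> view \<rho> s' = r)"
proof -
  obtain s' where s': "exec (rename_com \<rho> A) s t s'" "view \<rho> s' = r"
    "\<And>a. a \<notin> range \<rho> \<Longrightarrow> nmem s' a = nmem s a \<and> rmem s' a = rmem s a"
    using exec_rename[OF assms(1) inj_region] by blast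
  have "\<sigma> a \<notin> range \<rho>" "0 \<notin> range \<rho>" "1 \<notin> range \<rho>" "2 \<notin> range \<rho>" "3 \<notin> range \<rho>" for a
    by (auto simp: image_iff)
  then have "holds_input n es p ws s'" "view \<sigma> s' = v"
    using assms(2,3) s'(3) by (auto simp: holds_input_def view_eq_iff)
  with s'(1,2) show ?thesis
    by (auto simp: halts_within_def)
qed

lemma emit_correct:
  assumes "nmem s 3 d = i" "d < 2"
  shows "halts_within (emit \<rho> d) s (nmem s (\<rho> 0) 0 * 3 + 3)
    (\<lambda>s'. output_positions s' = map (skip_pos i) (output_positions (view \<rho> s)))"
proof -
  define N where "N = nmem s (\<rho> 0) 0"
  \<comment> \<open>Array 1 is being overwritten, so \<open>holds_input\<close> cannot be kept; the
    invariant retains the cells still to be read and the positions already written.\<close>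
  define P where "P k s' \<longleftrightarrow> nmem s' 3 d = i \<and> nmem s' (\<rho> 0) 0 = N \<and>
      nmem s' (\<rho> 1) = nmem s (\<rho> 1) \<and>
      (\<forall>l<k. nmem s' 1 l = skip_pos i (nmem s (\<rho> 1) l))" for k and s' :: state
  have "halts_within (for_loop (NRead (\<rho> 0) (NConst 0))
           (NWrite 1 counter (skip_nexp (NRead 3 (NConst d)) (NRead (\<rho> 1) counter)))) s
      (N * (1 + 2) + 2) (P N)"
  proof (rule halts_within_for_loop)
    show "P 0 (s\<lparr>nmem := (nmem s)(3 := (nmem s 3)(2 := 0))\<rparr>)"
      using assms by (simp add: P_def N_def)
    show "nval (NRead (\<rho> 0) (NConst 0)) s = N" if "P k s" for k s
      using that by (simp add: P_def)
    fix k s'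
    assume "P k s'" "nmem s' 3 2 = k"
    then show "halts_within (NWrite 1 counter (skip_nexp (NRead 3 (NConst d)) (NRead (\<rho> 1) counter)))
        s' 1 (\<lambda>s'. nmem s' 3 2 = k \<and>
        P (Suc k) (s'\<lparr>nmem := (nmem s')(3 := (nmem s' 3)(2 := Suc k))\<rparr>))"
      using assms(2) by (intro halts_within_NWrite) (auto simp: P_def less_Suc_eq)
  qed
  then have "halts_within (emit \<rho> d) s ((N * (1 + 2) + 2) + 1)
    (\<lambda>s'. output_positions s' = map (skip_pos i) (output_positions (view \<rho> s)))"
    unfolding emit_def
  proof (intro halts_within_Seq, elim halts_within_weaken)
    fix s'
    assume "P N s'"
    then show "halts_within (NWrite 0 (NConst 0) (NRead (\<rho> 0) (NConst 0))) s' 1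
        (\<lambda>s'. output_positions s' = map (skip_pos i) (output_positions (view \<rho> s)))"
      by (intro halts_within_NWrite) (auto simp: P_def N_def output_positions_def)
  qed simp
  then show ?thesis
    by (rule halts_within_weaken) (simp_all add: N_def)
qed

end

section \<open>Both runs together: correctness of the whole program\<close>

interpretation first: two_regions first_region second_region
  by unfold_locales (auto simp: first_region_def second_region_def inj_def, presburger)

interpretation second: two_regions second_region first_region
  by unfold_locales (auto simp: first_region_def second_region_def inj_def, presburger)

lemma edge_add_clique_correct:
  assumes "exec A (initial_state (graph_arrays (delete_pos i vs) (delete_edges i es))
      [map w (delete_pos i vs)]) t r"
    and "exec A (initial_state (graph_arrays (delete_pos j vs) (delete_edges j es))
      [map w (delete_pos j vs)]) t' r'"
    and "nmem r 0 0 \<le> length vs" "nmem r' 0 0 \<le> length vs"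
  shows "halts_within (edge_add_clique A)
    (initial_state (graph_arrays vs es @ [[i, j]]) [map w vs])
    (12 * length es + 9 * length vs + 14 + t + t')
    (\<lambda>s. output_positions s = (if rmem r 0 0 < rmem r' 0 0
       then map (skip_pos j) (output_positions r') else map (skip_pos i) (output_positions r)))"
    (is "halts_within _ ?s _ ?Q")
proof -
  define p where "p d = (if d = 0 then i else j)" for d :: nat
  let ?I = "holds_input (length vs) es p (map w vs)"
  let ?start = "\<lambda>i. initial_state (graph_arrays (delete_pos i vs) (delete_edges i es))
      [map w (delete_pos i vs)]"
  let ?zero = "initial_state [] []"
  let ?b = "6 * length es + 3 * length vs + 5"
  have p: "p 0 = i" "p 1 = j"
    by (simp_all add: p_def)
  have I: "?I ?s"
    by (auto simp: holds_input_def initial_state_def graph_arrays_def p_def array_of_def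
        less_Suc_eq numeral_2_eq_2 numeral_3_eq_3)
  have views: "view first_region ?s = ?zero" "view second_region ?s = ?zero"
    by (auto simp: view_eq_iff initial_state_def graph_arrays_def first_region_def
        second_region_def)
  have prep1: "halts_within (prepare first_region 0) ?s ?b
      (\<lambda>s. ?I s \<and> view second_region s = ?zero \<and> view first_region s = ?start i)"
    using first.prepare_correct[OF I, of 0] views
    by (simp add: p graph_arrays_def map_delete_pos)
  have run1: "halts_within (rename_com first_region A) s t
      (\<lambda>s. ?I s \<and> view second_region s = ?zero \<and> view first_region s = r)"
    if "?I s \<and> view second_region s = ?zero \<and> view first_region s = ?start i" for s
    using that assms(1) by (intro first.rename_correct) auto
  have prep2: "halts_within (prepare second_region 1) s ?b
      (\<lambda>s. ?I s \<and> view first_region s = r \<and> view second_region s = ?start j)"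
    if "?I s \<and> view second_region s = ?zero \<and> view first_region s = r" for s
    using second.prepare_correct[of "length vs" es p "map w vs" s 1] that
    by (simp add: p[simplified] graph_arrays_def map_delete_pos)
  have run2: "halts_within (rename_com second_region A) s t'
      (\<lambda>s. ?I s \<and> view first_region s = r \<and> view second_region s = r')"
    if "?I s \<and> view first_region s = r \<and> view second_region s = ?start j" for s
    using that assms(2) by (intro second.rename_correct) auto
  have "halts_within
      (Cond (RLess (RRead (first_region 0) (NConst 0)) (RRead (second_region 0) (NConst 0)))
           (emit second_region 1) (emit first_region 0)) s
      (Suc (max (3 * length vs + 3) (3 * length vs + 3))) ?Q"
    if s: "?I s \<and> view first_region s = r \<and> view second_region s = r'" for s
  proof (rule halts_within_Cond)
    have cells: "nmem s 3 0 = i" "nmem s 3 1 = j"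
      using s by (auto simp: holds_input_def p_def)
    have r: "nmem s (first_region 0) = nmem r 0" "rmem s (first_region 0) = rmem r 0"
      "nmem s (second_region 0) = nmem r' 0" "rmem s (second_region 0) = rmem r' 0"
      using s by (auto simp: view_eq_iff)
    let ?b = "RLess (RRead (first_region 0) (NConst 0)) (RRead (second_region 0) (NConst 0))"
    show "halts_within (emit second_region 1) s (3 * length vs + 3) ?Q" if "bval ?b s"
      by (rule halts_within_weaken[OF second.emit_correct[OF cells(2)]])
        (use that assms(4) r s in simp_all)
    show "halts_within (emit first_region 0) s (3 * length vs + 3) ?Q" if "\<not> bval ?b s"
      by (rule halts_within_weaken[OF first.emit_correct[OF cells(1)]])
        (use that assms(3) r s in simp_all)
  qed
  \<comment> \<open>Two preparations, the final comparison and an output phase of at most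
    \<open>3 * length vs + 3\<close> steps add up to
    \<open>12 * length es + 9 * length vs + 14\<close>, next to the two runs.\<close>
  then have "halts_within (edge_add_clique A) ?s
      (?b + (t + (?b + (t' + Suc (max (3 * length vs + 3) (3 * length vs + 3)))))) ?Q"
    unfolding edge_add_clique_def
    by (intro halts_within_Seq halts_within_weaken[OF prep1] halts_within_weaken[OF run1]
        halts_within_weaken[OF prep2] halts_within_weaken[OF run2] order_refl)
  then show ?thesis
    by (rule halts_within_weaken) simp_all
qed

text \<open>Position \<open>q\<close> of the shortened list and position \<open>skip_pos i q\<close>
  of \<open>vs\<close> name the same vertex, and \<open>skip_pos i\<close> is injective, so no
  repetition arises.\<close>

lemma outputs_set_delete:
  assumes "outputs_set (delete_pos i vs) r K" "distinct vs"
    and "output_positions s = map (skip_pos i) (output_positions r)"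
  shows "outputs_set vs s K"
proof -
  have less: "q < length vs - 1" if "q \<in> set (output_positions r)" for q
    using that assms(1) by (auto simp: outputs_set_def)
  have "K = (!) (delete_pos i vs) ` set (output_positions r)"
    using assms(1) by (simp add: outputs_set_def)
  also have "\<dots> = (!) vs ` skip_pos i ` set (output_positions r)"
    unfolding image_image using less by (intro image_cong) (simp_all add: nth_delete_pos)
  finally show ?thesis
    using assms(1) less
    by (auto simp: outputs_set_def assms(3) distinct_map skip_pos_less inj_on_subset[OF inj_skip_pos])
qed

text \<open>Needed for the running time of \<open>emit\<close>, whose number of rounds is a value
  returned by the given program.\<close>

lemma outputs_set_size_le:
  assumes "outputs_set vs s K"
  shows "nmem s 0 0 \<le> length vs"
proof -
  have "nmem s 0 0 = card (set (output_positions s))"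
    using assms by (simp add: outputs_set_def distinct_card) (simp add: output_positions_def)
  also have "\<dots> \<le> card {..<length vs}"
    using assms by (intro card_mono) (auto simp: outputs_set_def)
  finally show ?thesis
    by simp
qed

text \<open>\<open>mono\<close> combines two facts about \<open>U\<close>: it dominates
  \<open>T\<close>, and it still does so after passing to larger arguments. The factor 2 counts the
  runs; 12 covers both linear coefficients of the overhead.\<close>

lemma solves_weighted_max_clique_add:
  assumes her: "hereditary \<G>"
    and A: "solves_weighted_max_clique \<G> A T"
    and mono: "\<And>m m' n n'. m \<le> m' \<Longrightarrow> n \<le> n' \<Longrightarrow> T m n \<le> U m' n'"
  shows "solves_weighted_max_clique_add \<G> (edge_add_clique A)
    (\<lambda>m n. 12 * real (m + n) + 14 + 2 * U m n)"
  unfolding solves_weighted_max_clique_add_def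
proof (intro ballI allI impI)
  fix G x y w vs es i j
  assume G: "G \<in> edge_add_class \<G>" and xy: "nonedge G x y \<and> add_edge G x y \<in> \<G>"
    and "represents vs es G \<and> i < length vs \<and> vs ! i = x \<and> j < length vs \<and> vs ! j = y"
  then have rep: "represents vs es G" and i: "i < length vs" "vs ! i = x"
    and j: "j < length vs" "vs ! j = y"
    by auto
  have simple: "simple_graph G"
    using G by (simp add: edge_add_class_def)
  have dist: "distinct vs" and n: "card (verts G) = length vs"
    using rep by (auto simp: represents_def distinct_card[symmetric])
  have m: "card (edges G) = length es"
    using rep unfolding represents_def by (metis distinct_card length_map)
  have run: "\<exists>t r K. exec A (initial_state (graph_arrays (delete_pos k vs) (delete_edges k es))
        [map w (delete_pos k vs)]) t r \<and> real t \<le> U (card (edges G)) (card (verts G)) \<and>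
      outputs_set (delete_pos k vs) r K \<and>
      weighted_max_clique (induced G (verts G - {vs ! k})) w K \<and> rmem r 0 0 = (\<Sum>v\<in>K. w v)"
    if k: "k < length vs" "vs ! k \<in> {x, y}" for k
  proof -
    let ?H = "induced G (verts G - {vs ! k})"
    have "?H = induced (add_edge G x y) (verts G - {vs ! k})"
      using k(2) by (subst induced_add_edge) auto
    then have "?H \<in> \<G>"
      using her xy by (auto simp: hereditary_def add_edge_def)
    with A represents_delete[OF rep k(1)] obtain t r K where
      "exec A (initial_state (graph_arrays (delete_pos k vs) (delete_edges k es))
        [map w (delete_pos k vs)]) t r" "real t \<le> T (card (edges ?H)) (card (verts ?H))"
      "outputs_set (delete_pos k vs) r K" "weighted_max_clique ?H w K"
      "rmem r 0 0 = (\<Sum>v\<in>K. w v)"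
      unfolding solves_weighted_max_clique_def by metis
    moreover have "card (verts ?H) \<le> card (verts G)"
      using simple by (auto simp: induced_def simple_graph_def intro: card_mono)
    then have "T (card (edges ?H)) (card (verts ?H)) \<le> U (card (edges G)) (card (verts G))"
      using simple by (intro mono card_edges_induced_le)
    ultimately show ?thesis
      by (meson order_trans)
  qed
  obtain t r K where K: "exec A (initial_state (graph_arrays (delete_pos i vs) (delete_edges i es))
        [map w (delete_pos i vs)]) t r" "real t \<le> U (card (edges G)) (card (verts G))"
      "outputs_set (delete_pos i vs) r K"
      "weighted_max_clique (induced G (verts G - {x})) w K" "rmem r 0 0 = (\<Sum>v\<in>K. w v)"
    using run[of i] i by auto
  obtain t' r' L where L: "exec A (initial_state (graph_arrays (delete_pos j vs) (delete_edges j es))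
        [map w (delete_pos j vs)]) t' r'" "real t' \<le> U (card (edges G)) (card (verts G))"
      "outputs_set (delete_pos j vs) r' L"
      "weighted_max_clique (induced G (verts G - {y})) w L" "rmem r' 0 0 = (\<Sum>v\<in>L. w v)"
    using run[of j] j by auto
  have "nmem r 0 0 \<le> length vs" "nmem r' 0 0 \<le> length vs"
    using outputs_set_size_le[OF K(3)] outputs_set_size_le[OF L(3)] by simp_all
  from edge_add_clique_correct[OF K(1) L(1) this] obtain u s where
    s: "exec (edge_add_clique A) (initial_state (graph_arrays vs es @ [[i, j]]) [map w vs]) u s"
      "u \<le> 12 * length es + 9 * length vs + 14 + t + t'"
      "output_positions s = (if rmem r 0 0 < rmem r' 0 0
       then map (skip_pos j) (output_positions r') else map (skip_pos i) (output_positions r))"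
    unfolding halts_within_def by blast
  have "real u \<le> real (12 * length es + 9 * length vs + 14 + t + t')"
    using s(2) by (simp only: of_nat_le_iff)
  then have "real u \<le> 12 * real (card (edges G) + card (verts G)) + 14
      + 2 * U (card (edges G)) (card (verts G))"
    using K(2) L(2) by (simp add: m n)
  moreover have "\<exists>M. outputs_set vs s M \<and> weighted_max_clique G w M"
  proof (cases "rmem r 0 0 < rmem r' 0 0")
    case True
    then have "weighted_max_clique G w L"
      using weighted_max_clique_nonedge[OF nonedge_sym L(4) K(4)] xy K(5) L(5) by simp
    with True show ?thesis
      using outputs_set_delete[OF L(3) dist] s(3) by auto
  next
    case False
    then have "weighted_max_clique G w K"
      using weighted_max_clique_nonedge[OF _ K(4) L(4)] xy K(5) L(5) by simp
    with False show ?thesis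
      using outputs_set_delete[OF K(3) dist] s(3) by auto
  qed
  ultimately show "\<exists>t s K. exec (edge_add_clique A)
      (initial_state (graph_arrays vs es @ [[i, j]]) [map w vs]) t s \<and>
      real t \<le> 12 * real (card (edges G) + card (verts G)) + 14
        + 2 * U (card (edges G)) (card (verts G)) \<and>
      outputs_set vs s K \<and> weighted_max_clique G w K"
    using s(1) by blast
qed


section \<open>Time bounds\<close>

text \<open>The pair belonging to a subgraph may be exceptional although that of \<open>G\<close> is
  not, so a bound valid at every pair is extracted. The absolute value comes from the norm in the
  Landau symbol.\<close>

lemma bigo2_bound:
  assumes "bigo2 T f"
  obtains c d where "c \<ge> 0" "\<And>m n. T m n \<le> c * \<bar>f m n\<bar> + d"
proof -
  obtain c where c: "c > 0" "\<forall>\<^sub>F (m, n) in cofinite. \<bar>T m n\<bar> \<le> c * \<bar>f m n\<bar>"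
    using assms unfolding bigo2_def by (elim landau_o.bigE) (auto simp: case_prod_unfold)
  define F where "F = {(m, n). \<not> \<bar>T m n\<bar> \<le> c * \<bar>f m n\<bar>}"
  have "finite F"
    using c(2) by (simp add: eventually_cofinite F_def case_prod_unfold)
  \<comment> \<open>A sum over the finitely many exceptions dominates each of them.\<close>
  define d where "d = (\<Sum>(m, n)\<in>F. \<bar>T m n\<bar>)"
  have "T m n \<le> c * \<bar>f m n\<bar> + d" for m n
  proof (cases "(m, n) \<in> F")
    case True
    then have "\<bar>T m n\<bar> \<le> d"
      using member_le_sum[OF True, of "\<lambda>(m, n). \<bar>T m n\<bar>"] \<open>finite F\<close>
      by (auto simp: d_def)
    moreover have "c * \<bar>f m n\<bar> \<ge> 0"
      using c(1) by simp
    ultimately show ?thesis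
      by linarith
  next
    case False
    moreover have "d \<ge> 0"
      by (auto simp: d_def intro: sum_nonneg)
    ultimately show ?thesis
      by (auto simp: F_def)
  qed
  with c(1) show ?thesis
    by (intro that[of c d]) auto
qed

text \<open>Only \<open>(0, 0)\<close> has size 0, and the cofinite filter ignores it; elsewhere
  \<open>m + n \<ge> 1\<close>. The constant is \<open>\<bar>a\<bar> + 1\<close> because it has to
  be positive even for \<open>a = 0\<close>.\<close>

lemma const_bigo_size: "(\<lambda>_. a) \<in> O[cofinite](\<lambda>(m, n). real (m + n))"
proof (rule landau_o.bigI)
  show "\<bar>a\<bar> + 1 > 0"
    by simp
  have "{p. \<not> norm a \<le> (\<bar>a\<bar> + 1) * norm (case p of (m, n) \<Rightarrow> real (m + n))} \<subseteq> {(0, 0)}"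
  proof clarify
    fix m n
    assume *: "\<not> norm a \<le> (\<bar>a\<bar> + 1) * norm (real (m + n))"
    have "m + n = 0"
    proof (rule ccontr)
      assume "m + n \<noteq> 0"
      then have "(\<bar>a\<bar> + 1) * 1 \<le> (\<bar>a\<bar> + 1) * norm (real (m + n))"
        by (intro mult_left_mono) auto
      with * show False
        by simp
    qed
    then show "m = 0 \<and> n = 0"
      by simp
  qed
  then show "\<forall>\<^sub>F p in cofinite. norm a \<le> (\<bar>a\<bar> + 1) * norm (case p of (m, n) \<Rightarrow> real (m + n))"
    unfolding eventually_cofinite by (rule finite_subset) simp
qed

theorem theorem1:
  fixes \<G> :: "'a ugraph set" and f :: "nat \<Rightarrow> nat \<Rightarrow> real"
  assumes "graph_class \<G>" and "hereditary \<G>"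
    and "\<And>m m' n n'. m \<le> m' \<Longrightarrow> n \<le> n' \<Longrightarrow> f m n \<le> f m' n'"
    and "bigomega2 f (\<lambda>m n. real (m + n))"
    and "\<exists>A T. solves_weighted_max_clique \<G> A T \<and> bigo2 T f"
  shows "\<exists>B T. solves_weighted_max_clique_add \<G> B T \<and> bigo2 T f"
proof -
  obtain A T where A: "solves_weighted_max_clique \<G> A T" and "bigo2 T f"
    using assms(5) by blast
  then obtain c d where c: "c \<ge> 0" "\<And>m n. T m n \<le> c * \<bar>f m n\<bar> + d"
    using bigo2_bound by blast
  \<comment> \<open>\<open>f\<close> may be negative, so \<open>\<bar>f\<bar>\<close> need not be monotone; \<open>\<bar>f 0 0\<bar>\<close> makes up for this.\<close>
  define U where "U m n = c * (\<bar>f m n\<bar> + \<bar>f 0 0\<bar>) + d" for m n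
  have "T m n \<le> U m' n'" if "m \<le> m'" "n \<le> n'" for m m' n n'
  proof -
    have "\<bar>f m n\<bar> \<le> \<bar>f m' n'\<bar> + \<bar>f 0 0\<bar>"
      using assms(3)[OF that] assms(3)[of 0 m 0 n] by linarith
    then have "c * \<bar>f m n\<bar> \<le> c * (\<bar>f m' n'\<bar> + \<bar>f 0 0\<bar>)"
      using c(1) by (rule mult_left_mono)
    with c(2)[of m n] show ?thesis
      by (simp add: U_def)
  qed
  then have solves: "solves_weighted_max_clique_add \<G> (edge_add_clique A)
      (\<lambda>m n. 12 * real (m + n) + 14 + 2 * U m n)"
    by (rule solves_weighted_max_clique_add[OF assms(2) A])
  \<comment> \<open>The assumed lower bound on \<open>f\<close>, read as an upper bound for the cost
    of copying.\<close>
  have size: "(\<lambda>(m, n). real (m + n)) \<in> O[cofinite](\<lambda>(m, n). f m n)"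
    using assms(4) by (simp add: bigomega2_def bigomega_iff_bigo)
  have const: "(\<lambda>_. a) \<in> O[cofinite](\<lambda>(m, n). f m n)" for a :: real
    using const_bigo_size size by (rule landau_o.big_trans)
  have abs: "(\<lambda>(m, n). \<bar>f m n\<bar>) \<in> O[cofinite](\<lambda>(m, n). f m n)"
    by (rule landau_o.bigI[of 1]) (auto simp: case_prod_unfold)
  have cmult: "(\<lambda>p. a * g p) \<in> O[cofinite](\<lambda>(m, n). f m n)"
    if "g \<in> O[cofinite](\<lambda>(m, n). f m n)" for a :: real and g
    using that by (cases "a = 0") simp_all
  \<comment> \<open>The bound regrouped into a multiple of the size, a multiple of
    \<open>\<bar>f m n\<bar>\<close> and a constant, each of which is \<open>O(f)\<close>.\<close>
  have "(\<lambda>p. 12 * (case p of (m, n) \<Rightarrow> real (m + n)) +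
      (2 * c) * (case p of (m, n) \<Rightarrow> \<bar>f m n\<bar>) + (14 + 2 * (c * \<bar>f 0 0\<bar> + d)))
      \<in> O[cofinite](\<lambda>(m, n). f m n)"
    by (intro sum_in_bigo const cmult size abs)
  also have "(\<lambda>p. 12 * (case p of (m, n) \<Rightarrow> real (m + n)) +
      (2 * c) * (case p of (m, n) \<Rightarrow> \<bar>f m n\<bar>) + (14 + 2 * (c * \<bar>f 0 0\<bar> + d))) =
      (\<lambda>(m, n). 12 * real (m + n) + 14 + 2 * U m n)"
    by (auto simp: U_def fun_eq_iff algebra_simps)
  finally have "bigo2 (\<lambda>m n. 12 * real (m + n) + 14 + 2 * U m n) f"
    by (simp add: bigo2_def)
  with solves show ?thesis
    by blast
qed

end
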